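(* For every string $s$ of length $n$, the size of the grammar produced by the LZD parsing of $s$, and the size of the grammar produced by the LZMW parsing of $s$, are each at most $O((n/\log n)^{2/3})\cdot g^*(s)$, where $g^*(s)$ is the size of a smallest context-free grammar generating exactly $s$.
   Context: Strings are over a finite alphabet $\Sigma$, and by convention the input string ends with a special letter $\$$ occurring nowhere else. The LZD parsing of $s$ is $s=p_1\cdots p_z$ where, for each $i$, with $k=|p_1\cdots p_{i-1}|+1$, $p_i=p_{i_1}p_{i_2}$, $p_{i_1}$ is the longest prefix of $s[k..n]$ in $\{p_1,\dots,p_{i-1}\}\cup\Sigma$ and $p_{i_2}$ is the longest prefix of $s[k+|p_{i_1}|..n]$ in $\{p_1,\dots,p_{i-1}\}\cup\Sigma$. The LZMW parsing is $s=p_1\cdots p_z$ where $p_i$ is the longest prefix of $s[k..n]$ in $\{p_jp_{j+1}:1\le j\le i-2\}\cup\Sigma$. The grammar of a parsing has a rule $p_i\to p_jp_k$ ($j,k<i$) or $p_i\to a$ ($a\in\Sigma$) for each phrase and the start rule $S\to p_1\cdots p_z$; the size of a grammar is the total number of symbols on right-hand sides of its rules. *)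

theory Defs
  imports Complex_Main "HOL-Library.Sublist" "HOL-Library.Landau_Symbols"
begin

section \<open>Context-free grammars\<close>

datatype ('n, 't) sym = Nt 'n | Tm 't

type_synonym ('n, 't) prods = "('n \<times> ('n, 't) sym list) set"

definition derives1 :: "('n, 't) prods \<Rightarrow> ('n, 't) sym list \<Rightarrow> ('n, 't) sym list \<Rightarrow> bool" where
  "derives1 P u v \<longleftrightarrow>
     (\<exists>l A \<alpha> r. (A, \<alpha>) \<in> P \<and> u = l @ [Nt A] @ r \<and> v = l @ \<alpha> @ r)"

definition lang :: "('n, 't) prods \<Rightarrow> 'n \<Rightarrow> 't list set" where
  "lang P S = {w. (derives1 P)\<^sup>*\<^sup>* [Nt S] (map Tm w)}"

definition grammar_size :: "('n, 't) prods \<Rightarrow> nat" where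
  "grammar_size P = (\<Sum>(A, \<alpha>)\<in>P. length \<alpha>)"

text \<open>
  A finite grammar uses finitely many nonterminals, so it is no restriction to draw them
  from \<^typ>\<open>nat\<close>.
\<close>

definition smallest_grammar_size :: "'t list \<Rightarrow> nat" where
  "smallest_grammar_size s =
     (LEAST m. \<exists>(P :: (nat, 't) prods) S. finite P \<and> lang P S = {s} \<and> grammar_size P = m)"

section \<open>The LZD and LZMW parsings\<close>

definition terminated_by :: "'a \<Rightarrow> 'a list \<Rightarrow> bool" where
  "terminated_by d s \<longleftrightarrow> (\<exists>u. s = u @ [d] \<and> d \<notin> set u)"

definition longest_prefix_in :: "'a list set \<Rightarrow> 'a list \<Rightarrow> 'a list \<Rightarrow> bool" where
  "longest_prefix_in D w p \<longleftrightarrow>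
     p \<in> D \<and> prefix p w \<and> (\<forall>q\<in>D. prefix q w \<longrightarrow> length q \<le> length p)"

text \<open>
  In what follows \<open>qs\<close> is the list of the phrases preceding the current one and \<open>w\<close> is the
  suffix of the input that is still to be parsed. Lists are indexed from 0.
\<close>

definition parsing ::
    "('a list list \<Rightarrow> 'a list \<Rightarrow> 'a list \<Rightarrow> bool) \<Rightarrow> 'a list \<Rightarrow> 'a list list \<Rightarrow> bool" where
  "parsing is_next s ps \<longleftrightarrow>
     concat ps = s \<and> (\<forall>i<length ps. is_next (take i ps) (concat (drop i ps)) (ps ! i))"

definition LZD_dict :: "'a set \<Rightarrow> 'a list list \<Rightarrow> 'a list set" where
  "LZD_dict \<Sigma> qs = set qs \<union> {[a] |a. a \<in> \<Sigma>}"

text \<open>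
  The input may be exhausted after the first factor of the last phrase. The second factor is
  then empty; by the choice of the end marker, the first one is the end marker itself.
\<close>

definition LZD_factors ::
    "'a set \<Rightarrow> 'a list list \<Rightarrow> 'a list \<Rightarrow> 'a list \<Rightarrow> 'a list \<Rightarrow> bool" where
  "LZD_factors \<Sigma> qs w x y \<longleftrightarrow>
     longest_prefix_in (LZD_dict \<Sigma> qs) w x \<and>
     (let w' = drop (length x) w in
        if w' = [] then y = [] else longest_prefix_in (LZD_dict \<Sigma> qs) w' y)"

definition LZD_parsing :: "'a set \<Rightarrow> 'a list \<Rightarrow> 'a list list \<Rightarrow> bool" where
  "LZD_parsing \<Sigma> = parsing (\<lambda>qs w p. \<exists>x y. LZD_factors \<Sigma> qs w x y \<and> p = x @ y)"

definition LZMW_dict :: "'a set \<Rightarrow> 'a list list \<Rightarrow> 'a list set" where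
  "LZMW_dict \<Sigma> qs = {qs ! j @ qs ! Suc j |j. Suc j < length qs} \<union> {[a] |a. a \<in> \<Sigma>}"

definition LZMW_parsing :: "'a set \<Rightarrow> 'a list \<Rightarrow> 'a list list \<Rightarrow> bool" where
  "LZMW_parsing \<Sigma> = parsing (\<lambda>qs w p. longest_prefix_in (LZMW_dict \<Sigma> qs) w p)"

section \<open>The grammars produced by the parsings\<close>

datatype parse_nt = Start | Phrase nat

text \<open>
  Each phrase occurrence has a parse_nt of its own, so that equal LZMW phrases at
  different positions both contribute to the size.
\<close>

definition parsing_grammar ::
    "(nat \<Rightarrow> (parse_nt, 'a) sym list \<Rightarrow> bool) \<Rightarrow> 'a list list \<Rightarrow> (parse_nt, 'a) prods \<Rightarrow> bool"
where
  "parsing_grammar is_rhs ps P \<longleftrightarrow>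
     (\<exists>rhs. (\<forall>i<length ps. is_rhs i (rhs i)) \<and>
        P = insert (Start, map (\<lambda>i. Nt (Phrase i)) [0..<length ps])
              {(Phrase i, rhs i) |i. i < length ps})"

definition symbol_for :: "'a list list \<Rightarrow> 'a list \<Rightarrow> (parse_nt, 'a) sym \<Rightarrow> bool" where
  "symbol_for qs x X \<longleftrightarrow>
     (\<exists>j<length qs. X = Nt (Phrase j) \<and> x = qs ! j) \<or> (\<exists>a. X = Tm a \<and> x = [a])"

definition LZD_rhs ::
    "'a set \<Rightarrow> 'a list list \<Rightarrow> nat \<Rightarrow> (parse_nt, 'a) sym list \<Rightarrow> bool" where
  "LZD_rhs \<Sigma> ps i \<alpha> \<longleftrightarrow>
     (\<exists>x y X. LZD_factors \<Sigma> (take i ps) (concat (drop i ps)) x y \<and>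
        symbol_for (take i ps) x X \<and>
        (if y = [] then \<alpha> = [X] else \<exists>Y. symbol_for (take i ps) y Y \<and> \<alpha> = [X, Y]))"

definition LZD_grammar :: "'a set \<Rightarrow> 'a list \<Rightarrow> (parse_nt, 'a) prods \<Rightarrow> bool" where
  "LZD_grammar \<Sigma> s P \<longleftrightarrow>
     (\<exists>ps. LZD_parsing \<Sigma> s ps \<and> parsing_grammar (LZD_rhs \<Sigma> ps) ps P)"

text \<open>
  If a phrase equals the concatenation of several pairs of consecutive earlier phrases, any of
  these pairs may be used; the size of the grammar does not depend on the choice.
\<close>

definition LZMW_rhs :: "'a list list \<Rightarrow> nat \<Rightarrow> (parse_nt, 'a) sym list \<Rightarrow> bool" where
  "LZMW_rhs ps i \<alpha> \<longleftrightarrow>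
     (\<exists>j. Suc j < i \<and> ps ! i = ps ! j @ ps ! Suc j \<and> \<alpha> = [Nt (Phrase j), Nt (Phrase (Suc j))]) \<or>
     (\<exists>a. ps ! i = [a] \<and> \<alpha> = [Tm a])"

definition LZMW_grammar :: "'a set \<Rightarrow> 'a list \<Rightarrow> (parse_nt, 'a) prods \<Rightarrow> bool" where
  "LZMW_grammar \<Sigma> s P \<longleftrightarrow>
     (\<exists>ps. LZMW_parsing \<Sigma> s ps \<and> parsing_grammar (LZMW_rhs ps) ps P)"

section \<open>Existence of the objects defined above\<close>

lemma lang_singleton_prod:
  fixes S :: 'n and s :: "'t list"
  shows "lang {(S, map Tm s)} S = {s}"
proof -
  let ?P = "{(S, map Tm s)} :: ('n, 't) prods"
  have reach: "v = [Nt S] \<or> v = map Tm s" if "(derives1 ?P)\<^sup>*\<^sup>* [Nt S] v" for v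
    using that
  proof induction
    case base
    then show ?case by simp
  next
    case (step y z)
    have "y \<noteq> map Tm s"
    proof
      assume "y = map Tm s"
      with step.hyps(2) have "Nt S \<in> set (map Tm s :: ('n, 't) sym list)"
        by (auto simp: derives1_def simp del: set_map)
      then show False by auto
    qed
    with step.IH have "y = [Nt S]" by simp
    with step.hyps(2) show ?case
      by (auto simp: derives1_def Cons_eq_append_conv)
  qed
  have "derives1 ?P [Nt S] (map Tm s)"
    unfolding derives1_def by (intro exI[of _ "[]"] exI[of _ S] exI[of _ "map Tm s"]) simp
  then have "s \<in> lang ?P S" by (auto simp: lang_def)
  moreover have "w = s" if "w \<in> lang ?P S" for w
  proof -
    have "map Tm w = [Nt S] \<or> map Tm w = (map Tm s :: ('n, 't) sym list)"
      using reach that by (auto simp: lang_def)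
    then show ?thesis
    proof
      assume "map Tm w = (map Tm s :: ('n, 't) sym list)"
      then show ?thesis by (rule map_injective) (simp add: inj_def)
    qed auto
  qed
  ultimately show ?thesis by auto
qed

lemma smallest_grammar_size_attained:
  "\<exists>(P :: (nat, 't) prods) S. finite P \<and> lang P S = {s} \<and> grammar_size P = smallest_grammar_size s"
  unfolding smallest_grammar_size_def
  by (rule LeastI_ex) (metis finite.emptyI finite.insertI lang_singleton_prod)

lemma ex_longest_prefix_in:
  assumes "p \<in> D" "prefix p w"
  shows "\<exists>p. longest_prefix_in D w p"
proof -
  let ?A = "{q \<in> D. prefix q w}"
  have "finite ?A"
    by (rule finite_subset[of _ "set (prefixes w)"]) auto
  moreover have "?A \<noteq> {}" using assms by auto
  ultimately have "Max (length ` ?A) \<in> length ` ?A" "\<forall>r\<in>?A. length r \<le> Max (length ` ?A)"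
    by (intro Max_in; simp) (use \<open>finite ?A\<close> in simp)
  then obtain q where "q \<in> ?A" "\<forall>r\<in>?A. length r \<le> length q"
    by (metis (no_types, lifting) imageE)
  then show ?thesis by (auto simp: longest_prefix_in_def)
qed

lemma ex_longest_prefix_in_letters:
  assumes "{[a] |a. a \<in> \<Sigma>} \<subseteq> D" "set w \<subseteq> \<Sigma>" "w \<noteq> []"
  shows "\<exists>p. longest_prefix_in D w p \<and> p \<noteq> []"
proof -
  obtain a w' where w: "w = a # w'" using assms(3) by (cases w) auto
  then have a: "[a] \<in> D" "prefix [a] w" using assms by auto
  then obtain p where "longest_prefix_in D w p" using ex_longest_prefix_in by blast
  moreover from this a have "length [a] \<le> length p" by (auto simp only: longest_prefix_in_def)
  ultimately show ?thesis by auto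
qed

lemma ex_parsing:
  assumes progress: "\<And>qs w. set w \<subseteq> \<Sigma> \<Longrightarrow> w \<noteq> [] \<Longrightarrow> \<exists>p. is_next qs w p \<and> prefix p w \<and> p \<noteq> []"
    and "set s \<subseteq> \<Sigma>"
  shows "\<exists>ps. parsing is_next s ps"
proof -
  have "\<exists>ps. parsing is_next s ps"
    if "set w \<subseteq> \<Sigma>" "concat qs @ w = s"
      "\<forall>i<length qs. is_next (take i qs) (concat (drop i qs) @ w) (qs ! i)" for qs w
    using that
  proof (induction "length w" arbitrary: qs w rule: less_induct)
    case less
    show ?case
    proof (cases "w = []")
      case True
      with less.prems have "parsing is_next s qs" by (simp add: parsing_def)
      then show ?thesis by blast
    next
      case False
      then obtain p where p: "is_next qs w p" "prefix p w" "p \<noteq> []"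
        using progress less.prems(1) by blast
      then obtain v where w: "w = p @ v" by (auto simp: prefix_def)
      have "\<forall>i<length (qs @ [p]).
          is_next (take i (qs @ [p])) (concat (drop i (qs @ [p])) @ v) ((qs @ [p]) ! i)"
        using less.prems(3) p(1) w by (auto simp: nth_append less_Suc_eq)
      then show ?thesis
        using less.hyps[of v "qs @ [p]"] less.prems(1,2) w p(3) by auto
    qed
  qed
  from this[of s "[]"] assms(2) show ?thesis by simp
qed

lemma ex_LZD_factors:
  assumes "set w \<subseteq> \<Sigma>" "w \<noteq> []"
  shows "\<exists>x y. LZD_factors \<Sigma> qs w x y \<and> prefix (x @ y) w \<and> x \<noteq> []"
proof -
  have letters: "{[a] |a. a \<in> \<Sigma>} \<subseteq> LZD_dict \<Sigma> qs" by (auto simp: LZD_dict_def)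
  obtain x where x: "longest_prefix_in (LZD_dict \<Sigma> qs) w x" "x \<noteq> []"
    using ex_longest_prefix_in_letters[OF letters assms] by blast
  then obtain v where w: "w = x @ v" by (auto simp: longest_prefix_in_def prefix_def)
  show ?thesis
  proof (cases "v = []")
    case True
    with x w have "LZD_factors \<Sigma> qs w x [] \<and> prefix (x @ []) w \<and> x \<noteq> []"
      by (simp add: LZD_factors_def)
    then show ?thesis by blast
  next
    case False
    then obtain y where y: "longest_prefix_in (LZD_dict \<Sigma> qs) v y"
      using ex_longest_prefix_in_letters[OF letters, of v] assms(1) w by auto
    with x w False have "LZD_factors \<Sigma> qs w x y \<and> prefix (x @ y) w \<and> x \<noteq> []"
      by (auto simp: LZD_factors_def longest_prefix_in_def)
    then show ?thesis by blast
  qed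
qed

lemma ex_LZD_parsing:
  assumes "set s \<subseteq> \<Sigma>"
  shows "\<exists>ps. LZD_parsing \<Sigma> s ps"
  unfolding LZD_parsing_def
proof (rule ex_parsing[OF _ assms])
  fix qs :: "'a list list" and w :: "'a list"
  assume "set w \<subseteq> \<Sigma>" "w \<noteq> []"
  then obtain x y where "LZD_factors \<Sigma> qs w x y" "prefix (x @ y) w" "x \<noteq> []"
    using ex_LZD_factors by blast
  then show "\<exists>p. (\<exists>x y. LZD_factors \<Sigma> qs w x y \<and> p = x @ y) \<and> prefix p w \<and> p \<noteq> []"
    by (intro exI[of _ "x @ y"]) auto
qed

lemma ex_LZMW_parsing:
  assumes "set s \<subseteq> \<Sigma>"
  shows "\<exists>ps. LZMW_parsing \<Sigma> s ps"
  unfolding LZMW_parsing_def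
proof (rule ex_parsing[OF _ assms])
  fix qs :: "'a list list" and w :: "'a list"
  assume "set w \<subseteq> \<Sigma>" "w \<noteq> []"
  moreover have "{[a] |a. a \<in> \<Sigma>} \<subseteq> LZMW_dict \<Sigma> qs" by (auto simp: LZMW_dict_def)
  ultimately show "\<exists>p. longest_prefix_in (LZMW_dict \<Sigma> qs) w p \<and> prefix p w \<and> p \<noteq> []"
    using ex_longest_prefix_in_letters[of \<Sigma> "LZMW_dict \<Sigma> qs" w]
    by (auto simp: longest_prefix_in_def)
qed

lemma ex_parsing_grammar:
  assumes "\<And>i. i < length ps \<Longrightarrow> \<exists>\<alpha>. is_rhs i \<alpha>"
  shows "\<exists>P. parsing_grammar is_rhs ps P"
proof -
  from assms obtain rhs where "\<forall>i<length ps. is_rhs i (rhs i)" by metis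
  then show ?thesis unfolding parsing_grammar_def by blast
qed

lemma ex_symbol_for: "x \<in> LZD_dict \<Sigma> qs \<Longrightarrow> \<exists>X. symbol_for qs x X"
  by (auto simp: LZD_dict_def symbol_for_def in_set_conv_nth)

lemma ex_LZD_grammar:
  assumes "set s \<subseteq> \<Sigma>"
  shows "\<exists>P. LZD_grammar \<Sigma> s P"
proof -
  obtain ps where ps: "LZD_parsing \<Sigma> s ps" using ex_LZD_parsing[OF assms] by blast
  have "\<exists>\<alpha>. LZD_rhs \<Sigma> ps i \<alpha>" if i: "i < length ps" for i
  proof -
    obtain x y where xy: "LZD_factors \<Sigma> (take i ps) (concat (drop i ps)) x y"
      using ps i by (auto simp: LZD_parsing_def parsing_def)
    then obtain X where X: "symbol_for (take i ps) x X"
      using ex_symbol_for unfolding LZD_factors_def longest_prefix_in_def by blast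
    have "\<exists>Y. symbol_for (take i ps) y Y" if "y \<noteq> []"
    proof (rule ex_symbol_for)
      show "y \<in> LZD_dict \<Sigma> (take i ps)"
        using xy that by (auto simp: LZD_factors_def longest_prefix_in_def Let_def split: if_splits)
    qed
    with xy X show ?thesis unfolding LZD_rhs_def by metis
  qed
  then obtain P where "parsing_grammar (LZD_rhs \<Sigma> ps) ps P"
    using ex_parsing_grammar by blast
  with ps show ?thesis by (auto simp: LZD_grammar_def)
qed

lemma ex_LZMW_grammar:
  assumes "set s \<subseteq> \<Sigma>"
  shows "\<exists>P. LZMW_grammar \<Sigma> s P"
proof -
  obtain ps where ps: "LZMW_parsing \<Sigma> s ps" using ex_LZMW_parsing[OF assms] by blast
  have "\<exists>\<alpha>. LZMW_rhs ps i \<alpha>" if i: "i < length ps" for i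
  proof -
    have "ps ! i \<in> LZMW_dict \<Sigma> (take i ps)"
      using ps i by (auto simp: LZMW_parsing_def parsing_def longest_prefix_in_def)
    then show ?thesis using i unfolding LZMW_dict_def LZMW_rhs_def by fastforce
  qed
  then obtain P where "parsing_grammar (LZMW_rhs ps) ps P"
    using ex_parsing_grammar by blast
  with ps show ?thesis by (auto simp: LZMW_grammar_def)
qed

end

theory Submission
  imports Defs
begin

text \<open>
  A string with a grammar of size \<open>g\<close> has at most \<open>k * g\<close> distinct substrings of length \<open>k\<close>,
  because each of them first appears across a symbol boundary of some right-hand side. All LZD
  phrases but the last are pairwise distinct, and a string equals the concatenation of two
  consecutive LZMW phrases at most twice. So \<open>O(K\<^sup>2 g)\<close> phrases (or pairs) have length at most
  \<open>K\<close>, while \<open>O(n / K)\<close> are longer. With \<open>K\<close> about \<open>(n / g) powr (1/3)\<close> this gives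
  \<open>O(g * (n / g) powr (2/3))\<close> phrases, and \<open>g \<ge> log 2 n\<close> finishes the proof.
\<close>

section \<open>Straight-line subgrammars\<close>

fun sym_value :: "('n \<Rightarrow> 't list option) \<Rightarrow> ('n, 't) sym \<Rightarrow> 't list" where
  "sym_value M (Nt A) = the (M A)"
| "sym_value M (Tm a) = [a]"

definition word_value :: "('n \<Rightarrow> 't list option) \<Rightarrow> ('n, 't) sym list \<Rightarrow> 't list" where
  "word_value M \<alpha> = concat (map (sym_value M) \<alpha>)"

text \<open>Rules are added in an order in which each right-hand side uses only nonterminals that
  already have a value. Acyclicity and uniqueness of the rule for each nonterminal are thus built
  in, and \<open>M\<close> maps each nonterminal to its single word.\<close>

inductive straight_line :: "('n, 't) prods \<Rightarrow> ('n \<Rightarrow> 't list option) \<Rightarrow> bool" where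
  empty: "straight_line {} Map.empty"
| rule: "straight_line R M \<Longrightarrow> A \<notin> dom M \<Longrightarrow> {B. Nt B \<in> set \<alpha>} \<subseteq> dom M \<Longrightarrow>
    straight_line (insert (A, \<alpha>) R) (M(A \<mapsto> word_value M \<alpha>))"

lemma straight_line_finite: "straight_line R M \<Longrightarrow> finite R"
  by (induction rule: straight_line.induct) auto

lemma straight_line_dom: "straight_line R M \<Longrightarrow> dom M = fst ` R"
  by (induction rule: straight_line.induct) (simp_all del: fun_upd_apply)

lemma grammar_size_insert:
  assumes "finite R" "A \<notin> fst ` R"
  shows "grammar_size (insert (A, \<alpha>) R) = length \<alpha> + grammar_size R"
proof -
  have "(A, \<alpha>) \<notin> R" using assms(2) by (force simp: image_iff)
  then show ?thesis using assms(1) by (simp add: grammar_size_def)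
qed

lemma grammar_size_mono: "R \<subseteq> P \<Longrightarrow> finite P \<Longrightarrow> grammar_size R \<le> grammar_size P"
  unfolding grammar_size_def by (rule sum_mono2) auto

lemma derives_context:
  "(derives1 P)\<^sup>*\<^sup>* u v \<Longrightarrow> (derives1 P)\<^sup>*\<^sup>* (l @ u @ r) (l @ v @ r)"
proof (induction rule: rtranclp_induct)
  case base
  then show ?case by simp
next
  case (step y z)
  from step.hyps(2) obtain l' A \<alpha> r' where
    *: "(A, \<alpha>) \<in> P" "y = l' @ [Nt A] @ r'" "z = l' @ \<alpha> @ r'"
    unfolding derives1_def by blast
  have "derives1 P (l @ y @ r) (l @ z @ r)"
    unfolding derives1_def
    by (intro exI[of _ "l @ l'"] exI[of _ A] exI[of _ \<alpha>] exI[of _ "r' @ r"]) (simp add: *)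
  with step.IH show ?case by simp
qed

lemma derives_word_value:
  assumes "\<And>B. Nt B \<in> set \<alpha> \<Longrightarrow> (derives1 P)\<^sup>*\<^sup>* [Nt B] (map Tm (the (M B)))"
  shows "(derives1 P)\<^sup>*\<^sup>* \<alpha> (map Tm (word_value M \<alpha>))"
  using assms
proof (induction \<alpha>)
  case Nil
  then show ?case by (simp add: word_value_def)
next
  case (Cons X \<alpha>)
  have "(derives1 P)\<^sup>*\<^sup>* [X] (map Tm (sym_value M X))"
    using Cons.prems by (cases X) auto
  from derives_context[OF this, of "[]" \<alpha>]
  have "(derives1 P)\<^sup>*\<^sup>* (X # \<alpha>) (map Tm (sym_value M X) @ \<alpha>)" by simp
  moreover have "(derives1 P)\<^sup>*\<^sup>* \<alpha> (map Tm (word_value M \<alpha>))"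
    using Cons by simp
  from derives_context[OF this, of "map Tm (sym_value M X)" "[]"]
  have "(derives1 P)\<^sup>*\<^sup>* (map Tm (sym_value M X) @ \<alpha>)
          (map Tm (sym_value M X) @ map Tm (word_value M \<alpha>))" by simp
  ultimately show ?case by (simp add: word_value_def)
qed

text \<open>Soundness of the evaluation. The derivation is taken in the larger grammar
  \<open>P\<close>, so that the value of the start symbol is seen to lie in
  \<open>lang P S\<close>.\<close>

lemma straight_line_derives:
  assumes "straight_line R M" "R \<subseteq> P" "M A = Some x"
  shows "(derives1 P)\<^sup>*\<^sup>* [Nt A] (map Tm x)"
  using assms
proof (induction arbitrary: A x rule: straight_line.induct)
  case empty
  then show ?case by simp
next
  case (rule R M A' \<alpha>)
  show ?case
  proof (cases "A = A'")
    case True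
    have "(derives1 P)\<^sup>*\<^sup>* \<alpha> (map Tm (word_value M \<alpha>))"
    proof (rule derives_word_value)
      fix B assume "Nt B \<in> set \<alpha>"
      then have "B \<in> dom M" using rule.hyps by auto
      then show "(derives1 P)\<^sup>*\<^sup>* [Nt B] (map Tm (the (M B)))"
        using rule.IH rule.prems(1) by auto
    qed
    moreover have "derives1 P [Nt A] \<alpha>"
      using rule.prems(1) True unfolding derives1_def
      by (intro exI[of _ "[]"] exI[of _ A] exI[of _ \<alpha>]) simp
    ultimately show ?thesis using rule.prems(2) True by simp
  next
    case False
    then show ?thesis using rule.IH rule.prems by simp
  qed
qed

text \<open>
  A maximal straight-line subgrammar evaluates every productive nonterminal: a sentential form
  with a nonterminal outside its domain keeps such a nonterminal in every derivation step.
\<close>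

lemma ex_straight_line:
  fixes P :: "('n, 't) prods"
  assumes "finite P" "lang P S = {s}"
  shows "\<exists>R M. straight_line R M \<and> R \<subseteq> P \<and> M S = Some s"
proof -
  let ?Q = "\<lambda>c. \<exists>R (M :: 'n \<Rightarrow> 't list option). straight_line R M \<and> R \<subseteq> P \<and> card R = c"
  have "?Q 0" using straight_line.empty by fastforce
  moreover have "\<forall>c. ?Q c \<longrightarrow> c \<le> card P" using assms(1) card_mono by blast
  ultimately obtain c where c: "?Q c" "\<And>c'. ?Q c' \<Longrightarrow> c' \<le> c"
    using Nat.ex_has_greatest_nat[of ?Q 0 "card P"] by blast
  then obtain R M where RM: "straight_line R M" "R \<subseteq> P" "card R = c" by blast
  \<comment> \<open>Otherwise this rule could be added to \<open>R\<close>, giving a straight-line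
    subgrammar with more than the maximal number \<open>c\<close> of rules.\<close>
  have outside: "\<exists>B. Nt B \<in> set \<alpha> \<and> B \<notin> dom M" if "(A, \<alpha>) \<in> P" "A \<notin> dom M" for A \<alpha>
  proof (rule ccontr)
    assume "\<not> ?thesis"
    then have "{B. Nt B \<in> set \<alpha>} \<subseteq> dom M" by blast
    from straight_line.rule[OF RM(1) that(2) this]
    have "?Q (card (insert (A, \<alpha>) R))" using RM(2) that(1) by blast
    moreover have "(A, \<alpha>) \<notin> R" using that(2) straight_line_dom[OF RM(1)] by force
    then have "card (insert (A, \<alpha>) R) = Suc c" using straight_line_finite[OF RM(1)] RM(3) by simp
    ultimately have "Suc c \<le> c" using c(2)[of "Suc c"] by (simp only:)
    then show False by simp
  qed
  have stuck: "\<exists>B. Nt B \<in> set v \<and> B \<notin> dom M" if "(derives1 P)\<^sup>*\<^sup>* [Nt S] v" "S \<notin> dom M" for v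
    using that(1)
  proof (induction rule: rtranclp_induct)
    case base
    then show ?case using that(2) by auto
  next
    case (step y z)
    from step.hyps(2) obtain l A \<alpha> r where
      *: "(A, \<alpha>) \<in> P" "y = l @ [Nt A] @ r" "z = l @ \<alpha> @ r"
      unfolding derives1_def by blast
    from step.IH obtain B where B: "Nt B \<in> set y" "B \<notin> dom M" by blast
    show ?case
    proof (cases "B = A")
      case True
      then show ?thesis using outside[OF *(1)] B *(3) by auto
    next
      case False
      then have "Nt B \<in> set z" using B *(2,3) by auto
      then show ?thesis using B(2) by blast
    qed
  qed
  have "(derives1 P)\<^sup>*\<^sup>* [Nt S] (map Tm s)" using assms(2) by (auto simp: lang_def)
  from stuck[OF this] have "S \<in> dom M" by auto
  then obtain x where x: "M S = Some x" by blast
  \<comment> \<open>The value of \<open>S\<close> is itself a generated word, and \<open>s\<close>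
    is the only one.\<close>
  then have "x \<in> lang P S" using straight_line_derives[OF RM(1,2)] by (simp add: lang_def)
  then show ?thesis using assms(2) RM x by auto
qed

text \<open>A new right-hand side with m symbols has a value at most m times as long as the previous
  bound. The size grows by m, and m is at most 2^m.\<close>

lemma straight_line_length:
  assumes "straight_line R M" "M A = Some x"
  shows "length x \<le> 2 ^ grammar_size R"
  using assms
proof (induction arbitrary: A x rule: straight_line.induct)
  case empty
  then show ?case by simp
next
  case (rule R M A' \<alpha>)
  let ?g = "grammar_size R"
  have size: "grammar_size (insert (A', \<alpha>) R) = length \<alpha> + ?g"
    using rule.hyps straight_line_finite straight_line_dom grammar_size_insert by metis
  show ?case
  proof (cases "A = A'")
    case True
    have sym: "length (sym_value M X) \<le> 2 ^ ?g" if "X \<in> set \<alpha>" for X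
    proof (cases X)
      case (Nt B)
      then have "B \<in> dom M" using that rule.hyps by auto
      then show ?thesis using Nt rule.IH by auto
    qed simp
    have "length (word_value M \<alpha>) = (\<Sum>X\<leftarrow>\<alpha>. length (sym_value M X))"
      by (simp add: word_value_def length_concat comp_def)
    also have "\<dots> \<le> (\<Sum>X\<leftarrow>\<alpha>. 2 ^ ?g)" using sym by (rule sum_list_mono)
    also have "\<dots> = length \<alpha> * 2 ^ ?g" by (simp add: sum_list_triv)
    also have "\<dots> \<le> 2 ^ length \<alpha> * 2 ^ ?g"
      by (intro mult_right_mono) (simp_all add: less_imp_le)
    finally show ?thesis using True rule.prems size by (simp add: power_add)
  next
    case False
    then have "length x \<le> 2 ^ ?g" using rule by simp
    also have "\<dots> \<le> 2 ^ grammar_size (insert (A', \<alpha>) R)" by (rule power_increasing) (simp_all add: size)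
    finally show ?thesis .
  qed
qed

section \<open>Counting substrings\<close>

text \<open>The set \<open>E\<close> collects the windows of length \<open>k\<close> that need not
  occur inside the value of a single nonterminal. Splitting off the first symbol, at most
  \<open>k - 1\<close> windows cross the boundary behind it, and for \<open>k = 1\<close> a terminal
  is itself a window; so each symbol costs at most \<open>k\<close>.\<close>

lemma sublists_word_value:
  assumes "k \<ge> 1"
  shows "\<exists>E. finite E \<and> card E \<le> k * length \<alpha> \<and>
    {v. length v = k \<and> sublist v (word_value M \<alpha>)} \<subseteq>
      {v. length v = k \<and> (\<exists>B. Nt B \<in> set \<alpha> \<and> sublist v (the (M B)))} \<union> E"
proof (induction \<alpha>)
  case Nil
  then show ?case using assms by (intro exI[of _ "{}"]) (auto simp: word_value_def)
next
  case (Cons X \<alpha>)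
  then obtain E where E: "finite E" "card E \<le> k * length \<alpha>"
    "{v. length v = k \<and> sublist v (word_value M \<alpha>)} \<subseteq>
      {v. length v = k \<and> (\<exists>B. Nt B \<in> set \<alpha> \<and> sublist v (the (M B)))} \<union> E" by blast
  let ?x = "sym_value M X" and ?w = "word_value M \<alpha>"
  have val: "word_value M (X # \<alpha>) = ?x @ ?w" by (simp add: word_value_def)
  \<comment> \<open>The windows with \<open>j\<close> letters to the left of the boundary; both
    sides are nonempty, so \<open>j\<close> runs from 1 to \<open>k - 1\<close>. Truncation may add
    words of other lengths, which is harmless because only an upper bound on the cardinality
    matters.\<close>
  define C where "C = (\<lambda>j. drop (length ?x - j) ?x @ take (k - j) ?w) ` {1..<k}"
  \<comment> \<open>A terminal contributes only if \<open>k = 1\<close>; then \<open>C\<close> is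
    empty, so \<open>C\<close> and \<open>T\<close> together still have at most \<open>k\<close>
    elements.\<close>
  define T where "T = (case X of Nt _ \<Rightarrow> {} | Tm a \<Rightarrow> if k = 1 then {[a]} else {})"
  have "card C \<le> k - 1" unfolding C_def by (rule order.trans[OF card_image_le]) auto
  moreover have "finite C" "finite T" "card T \<le> (if k = 1 then 1 else 0)"
    by (auto simp: C_def T_def split: sym.split)
  ultimately have CT: "finite (C \<union> T)" "card (C \<union> T) \<le> k"
    using assms order.trans[OF card_Un_le[of C T], of k] by (auto split: if_splits)
  have "v \<in> {v. length v = k \<and> (\<exists>B. Nt B \<in> set (X # \<alpha>) \<and> sublist v (the (M B)))} \<union> (C \<union> T \<union> E)"
    if v: "length v = k" "sublist v (?x @ ?w)" for v
  proof -
    consider "sublist v ?x" | "sublist v ?w"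
      | (cross) v1 v2 where "v = v1 @ v2" "v1 \<noteq> []" "v2 \<noteq> []" "suffix v1 ?x" "prefix v2 ?w"
      using v(2) unfolding sublist_append
      by (metis append_Nil append_Nil2 prefix_imp_sublist suffix_imp_sublist)
    then show ?thesis
    proof cases
      case 1
      show ?thesis
      proof (cases X)
        case (Nt B)
        then show ?thesis using 1 v by auto
      next
        case (Tm a)
        then have "v = [a]" using 1 v(1) assms by (auto simp: sublist_Cons_right prefix_Cons)
        then show ?thesis using Tm v(1) by (auto simp: T_def)
      qed
    next
      case 2
      then show ?thesis using E(3) v(1) by auto
    next
      case cross
      have "v1 = drop (length ?x - length v1) ?x" "v2 = take (k - length v1) ?w"
        using cross v(1) by (auto simp: suffix_def prefix_def)
      moreover have "length v1 \<in> {1..<k}" using cross v(1) by (cases v1; cases v2) auto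
      ultimately have "v \<in> C" using cross(1) unfolding C_def by (metis (no_types, lifting) imageI)
      then show ?thesis by blast
    qed
  qed
  moreover have "card (C \<union> T \<union> E) \<le> k * length (X # \<alpha>)"
    using card_Un_le[of "C \<union> T" E] CT E by simp
  ultimately show ?case using CT E val by (intro exI[of _ "C \<union> T \<union> E"]) auto
qed

text \<open>Windows inside the value of a nonterminal on the new right-hand side were counted when
  that nonterminal was evaluated. Hence each rule adds at most \<open>k\<close> windows per
  symbol.\<close>

lemma straight_line_sublists:
  assumes "straight_line R M" "k \<ge> 1"
  shows "finite {v. length v = k \<and> (\<exists>A x. M A = Some x \<and> sublist v x)} \<and>
    card {v. length v = k \<and> (\<exists>A x. M A = Some x \<and> sublist v x)} \<le> k * grammar_size R"
  using assms(1)
proof (induction rule: straight_line.induct)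
  case empty
  then show ?case by simp
next
  case (rule R M A \<alpha>)
  let ?V = "{v. length v = k \<and> (\<exists>A x. M A = Some x \<and> sublist v x)}"
  let ?M = "M(A \<mapsto> word_value M \<alpha>)"
  let ?V' = "{v. length v = k \<and> (\<exists>A x. ?M A = Some x \<and> sublist v x)}"
  have size: "grammar_size (insert (A, \<alpha>) R) = length \<alpha> + grammar_size R"
    using rule.hyps straight_line_finite straight_line_dom grammar_size_insert by metis
  obtain E where E: "finite E" "card E \<le> k * length \<alpha>"
    "{v. length v = k \<and> sublist v (word_value M \<alpha>)} \<subseteq>
      {v. length v = k \<and> (\<exists>B. Nt B \<in> set \<alpha> \<and> sublist v (the (M B)))} \<union> E"
    using sublists_word_value[OF assms(2)] by blast
  have "{v. length v = k \<and> (\<exists>B. Nt B \<in> set \<alpha> \<and> sublist v (the (M B)))} \<subseteq> ?V"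
    using rule.hyps(3) by force
  then have sub: "?V' \<subseteq> ?V \<union> E" using E(3) by (auto split: if_splits)
  have fin: "finite (?V \<union> E)" using E(1) rule.IH by blast
  have "card ?V' \<le> card (?V \<union> E)" using sub fin by (rule card_mono[rotated])
  also have "\<dots> \<le> card ?V + card E" by (rule card_Un_le)
  also have "\<dots> \<le> k * grammar_size (insert (A, \<alpha>) R)"
    using rule.IH E(2) size by (simp add: algebra_simps)
  finally show ?case using finite_subset[OF sub fin] by blast
qed

section \<open>Bounds on the size of a smallest grammar\<close>

lemma smallest_grammar_straight_line:
  fixes s :: "'t list"
  shows "\<exists>(R :: (nat, 't) prods) M S. straight_line R M \<and> M S = Some s \<and>
    grammar_size R \<le> smallest_grammar_size s"
proof -
  obtain P :: "(nat, 't) prods" and S where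
    P: "finite P" "lang P S = {s}" "grammar_size P = smallest_grammar_size s"
    using smallest_grammar_size_attained by blast
  \<comment> \<open>A smallest grammar is not known in advance to be straight-line, but it contains
    a straight-line subgrammar that still yields \<open>s\<close>, and passing to a subset does not
    increase the size.\<close>
  obtain R M where "straight_line R M" "R \<subseteq> P" "M S = Some s"
    using ex_straight_line[OF P(1,2)] by blast
  then show ?thesis using grammar_size_mono[OF _ P(1)] P(3) by metis
qed

text \<open>This is the logarithmic lower bound on the smallest grammar size, stated without
  logarithms.\<close>

lemma length_le_smallest_grammar: "length s \<le> 2 ^ smallest_grammar_size s"
proof -
  obtain R :: "(nat, 'a) prods" and M S where "straight_line R M" "M S = Some s"
    "grammar_size R \<le> smallest_grammar_size s"
    using smallest_grammar_straight_line by blast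
  then show ?thesis
    using straight_line_length power_increasing[of _ _ "2::nat"]
    by (meson le_trans one_le_numeral)
qed

lemma card_sublists_le:
  assumes "k \<ge> 1"
  shows "card {v. length v = k \<and> sublist v s} \<le> k * smallest_grammar_size s"
proof -
  obtain R :: "(nat, 'a) prods" and M S where RM: "straight_line R M" "M S = Some s"
    "grammar_size R \<le> smallest_grammar_size s"
    using smallest_grammar_straight_line by blast
  let ?V = "{v. length v = k \<and> (\<exists>A x. M A = Some x \<and> sublist v x)}"
  have "card {v. length v = k \<and> sublist v s} \<le> card ?V"
    using straight_line_sublists[OF RM(1) assms] RM(2) by (intro card_mono) auto
  also have "\<dots> \<le> k * grammar_size R" using straight_line_sublists[OF RM(1) assms] by blast
  also have "\<dots> \<le> k * smallest_grammar_size s" using RM(3) by simp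
  finally show ?thesis .
qed

lemma smallest_grammar_size_le_length: "smallest_grammar_size s \<le> length s"
  unfolding smallest_grammar_size_def
proof (rule Least_le)
  have "grammar_size {(0::nat, map Tm s)} = length s" by (simp add: grammar_size_def)
  then show "\<exists>(P :: (nat, 'a) prods) S. finite P \<and> lang P S = {s} \<and> grammar_size P = length s"
    using lang_singleton_prod[of "0::nat" s] by blast
qed

lemma smallest_grammar_size_pos:
  assumes "s \<noteq> []"
  shows "smallest_grammar_size s \<ge> 1"
proof -
  let ?V = "{v. length v = 1 \<and> sublist v s}"
  have "[hd s] \<in> ?V" using assms by (cases s) auto
  moreover have "finite ?V" by (rule finite_subset[of _ "set (sublists s)"]) auto
  ultimately have "1 \<le> card ?V" by (metis One_nat_def Suc_leI card_gt_0_iff empty_iff)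
  then show ?thesis using card_sublists_le[of 1 s] by simp
qed

section \<open>From substring counts to bounds on families of substrings\<close>

lemma card_vimage_le:
  assumes "finite I" "finite W" "\<And>w. card {i \<in> I. q i = w} \<le> m"
  shows "card {i \<in> I. q i \<in> W} \<le> m * card W"
proof -
  have "{i \<in> I. q i \<in> W} = (\<Union>w\<in>W. {i \<in> I. q i = w})" by blast
  then have "card {i \<in> I. q i \<in> W} \<le> (\<Sum>w\<in>W. card {i \<in> I. q i = w})"
    using card_UN_le[OF assms(2)] by metis
  also have "\<dots> \<le> (\<Sum>w\<in>W. m)" using assms(3) by (rule sum_mono)
  finally show ?thesis by (simp add: mult.commute)
qed

text \<open>Members of length at most \<open>K\<close> take at most
  \<open>K ^ 2 * smallest_grammar_size s\<close> values, each at most twice; the longer ones are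
  limited by the total length. Both estimates are multiplied by \<open>K\<close> to avoid division
  in the natural numbers.\<close>

lemma card_substring_family_threshold:
  assumes "finite I" and ne: "\<And>i. i \<in> I \<Longrightarrow> q i \<noteq> [] \<and> sublist (q i) s"
    and mult: "\<And>w. card {i \<in> I. q i = w} \<le> 2"
    and total: "(\<Sum>i\<in>I. length (q i)) \<le> 2 * length s"
  shows "K * card I \<le> 2 * K ^ 3 * smallest_grammar_size s + 2 * length s"
proof -
  let ?g = "smallest_grammar_size s"
  define W where "W = (\<Union>k\<in>{1..K}. {v. length v = k \<and> sublist v s})"
  let ?short = "{i \<in> I. q i \<in> W}" and ?long = "{i \<in> I. q i \<notin> W}"
  have finW: "finite W"
    unfolding W_def by (rule finite_subset[of _ "set (sublists s)"]) auto
  have "card W \<le> (\<Sum>k\<in>{1..K}. card {v. length v = k \<and> sublist v s})"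
    unfolding W_def by (rule card_UN_le) simp
  also have "\<dots> \<le> (\<Sum>k\<in>{1..K}. K * ?g)"
  proof (rule sum_mono)
    fix k assume "k \<in> {1..K}"
    then show "card {v. length v = k \<and> sublist v s} \<le> K * ?g"
      using order.trans[OF card_sublists_le[of k s], of "K * ?g"] by simp
  qed
  also have "\<dots> = K ^ 2 * ?g" by (simp add: power2_eq_square)
  finally have "card ?short \<le> 2 * (K ^ 2 * ?g)"
    using card_vimage_le[OF assms(1) finW mult] by linarith
  then have "K * card ?short \<le> 2 * K ^ 3 * ?g"
    using mult_le_mono2[of _ _ K]
    by (simp add: power3_eq_cube power2_eq_square mult.assoc mult.left_commute)
  moreover have "K * card ?long \<le> 2 * length s"
  proof -
    have "K \<le> length (q i)" if "i \<in> ?long" for i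
    proof (rule ccontr)
      assume "\<not> ?thesis"
      \<comment> \<open>\<open>W\<close> starts at length 1, so nonemptiness is what makes every
        member outside \<open>W\<close> long.\<close>
      moreover have "length (q i) \<ge> 1" using ne that by (cases "q i") auto
      ultimately have "q i \<in> W" using ne that unfolding W_def by auto
      then show False using that by simp
    qed
    then have "K * card ?long \<le> (\<Sum>i\<in>?long. length (q i))"
      using sum_mono[of ?long "\<lambda>_. K" "\<lambda>i. length (q i)"] by (simp add: mult.commute)
    also have "\<dots> \<le> (\<Sum>i\<in>I. length (q i))" using assms(1) by (intro sum_mono2) auto
    finally show ?thesis using total by simp
  qed
  moreover have "card I = card ?short + card ?long"
  proof -
    have "I = ?short \<union> ?long" by blast
    then show ?thesis using assms(1) card_Un_disjoint[of ?short ?long] by auto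
  qed
  ultimately show ?thesis by (simp add: algebra_simps)
qed

text \<open>The constant 33 is 3 * (10 + 1): three symbols per phrase, a factor 10 from the
  threshold estimate, and one extra phrase. The maximum with 1 matters at n = 1, where the logarithm
  is 0 and division by it would yield 0.\<close>

definition ratio_bound :: "nat \<Rightarrow> real" where
  "ratio_bound n = 33 * (real n / max 1 (log 2 (real n))) powr (2/3)"

text \<open>The left-hand side is shaped for the parsings: \<open>I\<close> will index all phrases
  but the last, and each phrase contributes at most three symbols to the grammar.\<close>

lemma card_substring_family_le:
  assumes "s \<noteq> []" and "finite I" and "\<And>i. i \<in> I \<Longrightarrow> q i \<noteq> [] \<and> sublist (q i) s"
    and "\<And>w. card {i \<in> I. q i = w} \<le> 2"
    and "(\<Sum>i\<in>I. length (q i)) \<le> 2 * length s"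
  shows "3 * (real (card I) + 1) \<le> ratio_bound (length s) * smallest_grammar_size s"
proof -
  define n where "n = real (length s)"
  define g where "g = real (smallest_grammar_size s)"
  \<comment> \<open>This choice balances the two contributions: \<open>t ^ 3 = n / g\<close> makes g
    * t^2 equal to n / t.\<close>
  define t where "t = (n / g) powr (1/3)"
  define K where "K = nat \<lceil>t\<rceil>"
  have g1: "g \<ge> 1" using smallest_grammar_size_pos[OF assms(1)] by (simp add: g_def)
  have gn: "g \<le> n" using smallest_grammar_size_le_length[of s] by (simp add: g_def n_def)
  have t1: "t \<ge> 1" unfolding t_def using g1 gn by (intro ge_one_powr_ge_zero) (simp_all add: field_simps)
  have t2: "t\<^sup>2 = (n / g) powr (2/3)"
    by (simp add: t_def power2_eq_square flip: powr_add)
  have "t ^ 3 = (n / g) powr 1"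
    by (simp add: t_def power3_eq_cube flip: powr_add)
  then have t3: "n = g * t ^ 3" using g1 gn by simp
  \<comment> \<open>Since t \<ge> 1, rounding up at most doubles it; this turns the factor 2 of the
    short members into 8 below.\<close>
  have Kt: "t \<le> K" "real K \<le> 2 * t" unfolding K_def using t1 by linarith+
  have "real (K * card I) \<le> real (2 * K ^ 3 * smallest_grammar_size s + 2 * length s)"
    using card_substring_family_threshold[OF assms(2-5)] by (simp only: of_nat_le_iff)
  then have "K * card I \<le> 2 * real K ^ 3 * g + 2 * n" by (simp add: g_def n_def)
  also have "n \<le> g * t\<^sup>2 * K"
    using Kt(1) g1 t1 unfolding t3 by (simp add: power3_eq_cube power2_eq_square)
  also have "2 * real K ^ 3 * g \<le> 8 * (g * t\<^sup>2) * K"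
  proof -
    have "(real K)\<^sup>2 \<le> (2 * t)\<^sup>2" using Kt(2) by (intro power_mono) auto
    then have "(real K)\<^sup>2 * (2 * g * K) \<le> (2 * t)\<^sup>2 * (2 * g * K)"
      using g1 by (intro mult_right_mono) auto
    then show ?thesis by (simp add: power3_eq_cube power2_eq_square algebra_simps)
  qed
  finally have "K * card I \<le> K * (10 * (g * t\<^sup>2))" by (simp add: algebra_simps)
  then have "card I \<le> 10 * (g * t\<^sup>2)" using Kt t1 by simp
  \<comment> \<open>This absorbs the extra phrase, raising the factor 10 to 11.\<close>
  moreover have "1 \<le> g * t\<^sup>2" using g1 t1 mult_mono[of 1 g 1 "t\<^sup>2"] by simp
  ultimately have "3 * (real (card I) + 1) \<le> 33 * t\<^sup>2 * g" by (simp add: mult_ac)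
  \<comment> \<open>Here g \<ge> log 2 n enters: t^2 is (n / g) to the power 2/3, and g is at least
    both 1 and \<open>log 2 n\<close>.\<close>
  moreover have "t\<^sup>2 \<le> (n / max 1 (log 2 n)) powr (2/3)"
  proof -
    have "real (length s) \<le> real (2 ^ smallest_grammar_size s)"
      using length_le_smallest_grammar of_nat_le_iff by blast
    then have "n \<le> 2 powr g" by (simp add: n_def g_def powr_realpow)
    then have "log 2 n \<le> g" using g1 gn by (simp add: log_le_iff)
    then have "n / g \<le> n / max 1 (log 2 n)" using g1 gn by (intro divide_left_mono) auto
    then show ?thesis unfolding t2 using g1 gn by (intro powr_mono2) auto
  qed
  then have "33 * t\<^sup>2 * g \<le> 33 * (n / max 1 (log 2 n)) powr (2/3) * g"
    using g1 by (intro mult_right_mono) auto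
  ultimately show ?thesis by (simp add: ratio_bound_def n_def g_def)
qed

section \<open>The parsings\<close>

text \<open>Each phrase accounts for one symbol of the start rule and at most two of its own
  rule.\<close>

lemma parsing_grammar_size:
  assumes "parsing_grammar is_rhs ps P" "\<And>i \<alpha>. is_rhs i \<alpha> \<Longrightarrow> length \<alpha> \<le> 2"
  shows "grammar_size P \<le> 3 * length ps"
proof -
  obtain rhs where rhs: "\<forall>i<length ps. is_rhs i (rhs i)"
    "P = insert (Start, map (\<lambda>i. Nt (Phrase i)) [0..<length ps])
           ((\<lambda>i. (Phrase i, rhs i)) ` {..<length ps})"
    using assms(1) unfolding parsing_grammar_def image_def by auto
  have "grammar_size P = length ps + (\<Sum>i<length ps. length (rhs i))"
    unfolding grammar_size_def rhs(2)
    by (subst sum.insert) (auto simp: sum.reindex inj_on_def)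
  also have "\<dots> \<le> length ps + (\<Sum>i<length ps. 2)"
    using rhs(1) assms(2) by (intro add_left_mono sum_mono) auto
  finally show ?thesis by simp
qed

lemma concat_drop_nth:
  "i < length ps \<Longrightarrow> concat (drop i ps) = ps ! i @ concat (drop (Suc i) ps)"
  by (metis Cons_nth_drop_Suc concat.simps(2))

lemma concat_split:
  "i < length ps \<Longrightarrow> concat ps = concat (take i ps) @ ps ! i @ concat (drop (Suc i) ps)"
  by (metis append_take_drop_id concat_append concat_drop_nth)

lemma sum_length_nth: "(\<Sum>i<length ps. length (ps ! i)) = length (concat ps)"
  by (simp add: length_concat sum_list_sum_nth atLeast0LessThan)

section \<open>The LZD parsing\<close>

lemma LZD_nonempty:
  assumes "LZD_parsing \<Sigma> s ps" "i < length ps"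
  shows "ps ! i \<noteq> []"
  using assms(2)
proof (induction i rule: less_induct)
  case (less i)
  then have "[] \<notin> set (take i ps)" by (auto simp: in_set_conv_nth)
  then have "[] \<notin> LZD_dict \<Sigma> (take i ps)" by (auto simp: LZD_dict_def)
  moreover obtain x y where "LZD_factors \<Sigma> (take i ps) (concat (drop i ps)) x y" "ps ! i = x @ y"
    using assms(1) less.prems unfolding LZD_parsing_def parsing_def by blast
  ultimately show ?case by (auto simp: LZD_factors_def longest_prefix_in_def)
qed

text \<open>If phrase \<open>i\<close>, with factors \<open>x\<close> and \<open>y\<close>, had
  occurred before, then \<open>x @ y\<close> would be in the dictionary and would beat
  \<open>x\<close> as first factor. The last phrase is excluded because its second factor may be
  empty.\<close>

lemma LZD_distinct:
  assumes "LZD_parsing \<Sigma> s ps" "Suc i < length ps" "j < i"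
  shows "ps ! j \<noteq> ps ! i"
proof
  assume eq: "ps ! j = ps ! i"
  let ?D = "LZD_dict \<Sigma> (take i ps)" and ?w = "concat (drop i ps)"
  obtain x y where xy: "LZD_factors \<Sigma> (take i ps) ?w x y" "ps ! i = x @ y"
    using assms unfolding LZD_parsing_def parsing_def by (meson Suc_lessD)
  have w: "?w = x @ y @ ps ! Suc i @ concat (drop (Suc (Suc i)) ps)"
    using concat_drop_nth[of i ps] concat_drop_nth[of "Suc i" ps] assms(2) xy(2) by simp
  \<comment> \<open>The nonempty phrase \<open>Suc i\<close> still follows, so \<open>y\<close> is a
    dictionary word and not the default \<open>[]\<close>.\<close>
  then have "drop (length x) ?w \<noteq> []" using LZD_nonempty[OF assms(1,2)] by simp
  then have y: "y \<in> ?D" using xy(1) by (auto simp: LZD_factors_def Let_def longest_prefix_in_def)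
  have "[] \<notin> ?D"
    using LZD_nonempty[OF assms(1)] assms(2) by (auto simp: LZD_dict_def in_set_conv_nth)
  then have "y \<noteq> []" using y by metis
  moreover have "x @ y \<in> ?D"
    using eq xy(2) assms(2,3) by (auto simp: LZD_dict_def in_set_conv_nth)
  then have "length (x @ y) \<le> length x"
    using xy(1) w unfolding LZD_factors_def longest_prefix_in_def by (metis append.assoc prefixI)
  ultimately show False by simp
qed

lemma LZD_bound:
  assumes "LZD_grammar \<Sigma> s P" "s \<noteq> []"
  shows "grammar_size P \<le> ratio_bound (length s) * smallest_grammar_size s"
proof -
  obtain ps where ps: "LZD_parsing \<Sigma> s ps" "parsing_grammar (LZD_rhs \<Sigma> ps) ps P"
    using assms(1) unfolding LZD_grammar_def by blast
  have s: "s = concat ps" using ps(1) by (simp add: LZD_parsing_def parsing_def)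
  let ?I = "{..<length ps - 1}"
  have "3 * (real (card ?I) + 1) \<le> ratio_bound (length s) * smallest_grammar_size s"
  proof (rule card_substring_family_le[OF assms(2), where q = "\<lambda>i. ps ! i"])
    fix i assume "i \<in> ?I"
    then show "ps ! i \<noteq> [] \<and> sublist (ps ! i) s"
      using LZD_nonempty[OF ps(1), of i] concat_split[of i ps] by (auto simp: s)
  next
    fix w
    have "inj_on ((!) ps) ?I"
    proof (rule linorder_inj_onI)
      fix j i assume "j < i" "j \<in> ?I" "i \<in> ?I"
      then show "ps ! j \<noteq> ps ! i" using LZD_distinct[OF ps(1)] by auto
    qed auto
    then have "card {i \<in> ?I. ps ! i = w} \<le> 1"
      by (intro card_le_Suc0_iff_eq[THEN iffD2, simplified One_nat_def[symmetric]])
        (auto dest: inj_onD)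
    then show "card {i \<in> ?I. ps ! i = w} \<le> 2" by simp
  next
    have "(\<Sum>i\<in>?I. length (ps ! i)) \<le> (\<Sum>i<length ps. length (ps ! i))" by (intro sum_mono2) auto
    then show "(\<Sum>i\<in>?I. length (ps ! i)) \<le> 2 * length s" by (simp add: sum_length_nth s)
  qed simp
  moreover have "grammar_size P \<le> 3 * length ps"
    using ps(2) by (rule parsing_grammar_size) (auto simp: LZD_rhs_def split: if_splits)
  then have "real (grammar_size P) \<le> 3 * (real (card ?I) + 1)" by simp
  ultimately show ?thesis by linarith
qed

section \<open>The LZMW parsing\<close>

lemma LZMW_nonempty:
  assumes "LZMW_parsing \<Sigma> s ps" "i < length ps"
  shows "ps ! i \<noteq> []"
  using assms(2)
proof (induction i rule: less_induct)
  case (less i)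
  have "ps ! i \<in> LZMW_dict \<Sigma> (take i ps)"
    using assms(1) less.prems by (auto simp: LZMW_parsing_def parsing_def longest_prefix_in_def)
  then show ?case using less by (auto simp: LZMW_dict_def)
qed

text \<open>If pair \<open>j\<close> is complete before phrase \<open>i\<close>, its concatenation
  is in the dictionary and would be a longer choice than \<open>ps ! i\<close>. Overlapping pairs
  can agree: with distinct letters a and $, the string aaa$ is parsed into single letters, and its
  first two pairs both give aa.\<close>

lemma LZMW_pairs_distinct:
  assumes "LZMW_parsing \<Sigma> s ps" "Suc i < length ps" "Suc j < i"
  shows "ps ! j @ ps ! Suc j \<noteq> ps ! i @ ps ! Suc i"
proof
  assume eq: "ps ! j @ ps ! Suc j = ps ! i @ ps ! Suc i"
  let ?D = "LZMW_dict \<Sigma> (take i ps)" and ?w = "concat (drop i ps)"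
  have longest: "longest_prefix_in ?D ?w (ps ! i)"
    using assms by (auto simp: LZMW_parsing_def parsing_def)
  have "take i ps ! j @ take i ps ! Suc j \<in> ?D"
    using assms(2,3) unfolding LZMW_dict_def by (intro UnI1 CollectI exI[of _ j]) simp
  then have "ps ! i @ ps ! Suc i \<in> ?D" using assms(2,3) eq by simp
  moreover have "prefix (ps ! i @ ps ! Suc i) ?w"
    using concat_drop_nth[of i ps] concat_drop_nth[of "Suc i" ps] assms(2) by simp
  ultimately have "length (ps ! i @ ps ! Suc i) \<le> length (ps ! i)"
    using longest unfolding longest_prefix_in_def by blast
  then show False using LZMW_nonempty[OF assms(1,2)] by simp
qed

text \<open>LZMW phrases may repeat, so the counting is applied to concatenations of consecutive
  phrases; there is one pair fewer than there are phrases.\<close>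

lemma LZMW_bound:
  assumes "LZMW_grammar \<Sigma> s P" "s \<noteq> []"
  shows "grammar_size P \<le> ratio_bound (length s) * smallest_grammar_size s"
proof -
  obtain ps where ps: "LZMW_parsing \<Sigma> s ps" "parsing_grammar (LZMW_rhs ps) ps P"
    using assms(1) unfolding LZMW_grammar_def by blast
  have s: "s = concat ps" using ps(1) by (simp add: LZMW_parsing_def parsing_def)
  let ?I = "{..<length ps - 1}" and ?q = "\<lambda>i. ps ! i @ ps ! Suc i"
  have "3 * (real (card ?I) + 1) \<le> ratio_bound (length s) * smallest_grammar_size s"
  proof (rule card_substring_family_le[OF assms(2), where q = ?q])
    fix i assume i: "i \<in> ?I"
    then have "s = concat (take i ps) @ ?q i @ concat (drop (Suc (Suc i)) ps)"
      using concat_split[of i ps] concat_drop_nth[of "Suc i" ps] by (simp add: s)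
    then have "sublist (?q i) s" unfolding sublist_def by blast
    then show "?q i \<noteq> [] \<and> sublist (?q i) s"
      using LZMW_nonempty[OF ps(1), of i] i by simp
  next
    fix w
    let ?A = "{i \<in> ?I. ?q i = w}"
    show "card ?A \<le> 2"
    proof (cases "?A = {}")
      case False
      define m where "m = Min ?A"
      have fin: "finite ?A" by simp
      have m: "m \<in> ?A" unfolding m_def using fin False by (rule Min_in)
      \<comment> \<open>Any index with the same concatenation as the least one, \<open>m\<close>,
        can only be \<open>m\<close> or the overlapping \<open>Suc m\<close>.\<close>
      have "i \<in> {m, Suc m}" if i: "i \<in> ?A" for i
      proof -
        have "m \<le> i" unfolding m_def using fin i by (rule Min_le)
        moreover have "\<not> Suc m < i"
          using LZMW_pairs_distinct[OF ps(1), of i m] m i less_diff_conv[of i "length ps" 1] by auto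
        ultimately show ?thesis by auto
      qed
      then have "card ?A \<le> card {m, Suc m}" by (intro card_mono) auto
      then show ?thesis by simp
    next
      case True
      then show ?thesis by (simp only: card.empty)
    qed
  next
    \<comment> \<open>Every phrase belongs to at most two pairs, which is where the factor 2 in the
      total length comes from.\<close>
    have "(\<Sum>i\<in>?I. length (?q i)) = (\<Sum>i\<in>?I. length (ps ! i)) + (\<Sum>i\<in>Suc ` ?I. length (ps ! i))"
      by (simp add: sum.distrib sum.reindex)
    also have "\<dots> \<le> (\<Sum>i<length ps. length (ps ! i)) + (\<Sum>i<length ps. length (ps ! i))"
      by (intro add_mono sum_mono2) auto
    finally show "(\<Sum>i\<in>?I. length (?q i)) \<le> 2 * length s" by (simp add: sum_length_nth s)
  qed simp
  moreover have "grammar_size P \<le> 3 * length ps"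
    using ps(2) by (rule parsing_grammar_size) (auto simp: LZMW_rhs_def)
  then have "real (grammar_size P) \<le> 3 * (real (card ?I) + 1)" by simp
  ultimately show ?thesis by linarith
qed

section \<open>Asymptotic form of the bound and conclusion\<close>

lemma ratio_bound_bigo: "ratio_bound \<in> O(\<lambda>n::nat. (real n / log 2 (real n)) powr (2/3))"
proof (rule bigoI[where c = 33])
  show "\<forall>\<^sub>F n in sequentially.
    norm (ratio_bound n) \<le> 33 * norm ((real n / log 2 (real n)) powr (2/3))"
    \<comment> \<open>From n = 2 on the logarithm is at least 1, so the maximum in
      \<open>ratio_bound\<close> disappears.\<close>
    using eventually_ge_at_top[of 2]
  proof eventually_elim
    case (elim n)
    then have "log 2 (real n) \<ge> 1" by (simp add: le_log_iff)
    then show ?case by (simp add: ratio_bound_def max_def)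
  qed
qed

theorem theorem2:
  shows "\<exists>f \<in> O(\<lambda>n::nat. (real n / log 2 (real n)) powr (2/3)).
           \<forall>(\<Sigma> :: 'a set) (dollar :: 'a) (s :: 'a list).
             finite \<Sigma> \<longrightarrow> set s \<subseteq> \<Sigma> \<longrightarrow> terminated_by dollar s \<longrightarrow>
               (\<forall>P. LZD_grammar \<Sigma> s P \<longrightarrow>
                  real (grammar_size P) \<le> f (length s) * real (smallest_grammar_size s)) \<and>
               (\<forall>P. LZMW_grammar \<Sigma> s P \<longrightarrow>
                  real (grammar_size P) \<le> f (length s) * real (smallest_grammar_size s))"
proof (rule bexI[OF _ ratio_bound_bigo], intro allI impI)
  fix \<Sigma> :: "'a set" and dollar :: 'a and s :: "'a list"
  assume "terminated_by dollar s"
  then have "s \<noteq> []" by (auto simp: terminated_by_def)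
  then show "(\<forall>P. LZD_grammar \<Sigma> s P \<longrightarrow>
                  real (grammar_size P) \<le> ratio_bound (length s) * real (smallest_grammar_size s)) \<and>
               (\<forall>P. LZMW_grammar \<Sigma> s P \<longrightarrow>
                  real (grammar_size P) \<le> ratio_bound (length s) * real (smallest_grammar_size s))"
    using LZD_bound LZMW_bound by blast
qed

end
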